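(* Let $a,b,m\in\mathbb{Z}$ with $a\ge 2$, $m>1$, $\gcd(b,m)=1$, and $b>-(a-1)m$. Let $S=S_{a,b}(m)$, and let $n$ be the smallest positive integer such that $A_n\ge m$. Then $\{s_0,\ldots,s_{n-1}\}\subseteq \operatorname{msg}(S)$. In particular, $\operatorname{e}(S)\ge n$.
   Context: $\mathbb{N}=\{0,1,2,\dots\}$. A numerical semigroup is a submonoid of $(\mathbb{N},+)$ with finite complement in $\mathbb{N}$. Every numerical semigroup $S$ has a unique minimal system of generators, which is finite, denoted $\operatorname{msg}(S)$; its cardinality is the embedding dimension $\operatorname{e}(S)$. Let $T_{a,b}(z)=az+b$, with $T_{a,b}^i$ its $i$-fold composition ($T_{a,b}^0$ the identity), and let $S_{a,b}(m)=\langle T_{a,b}^i(m)\mid i\ge 0\rangle$ be the submonoid of $\mathbb{N}$ generated by the orbit of $m$; under the stated hypotheses it is a numerical semigroup of multiplicity (smallest positive element) $m$. Set $d=(a-1)m+b$, $A_i=(a^i-1)/(a-1)$ for $i\ge 0$, and $s_i=T_{a,b}^i(m)=m+A_id$ for $i\ge 0$. *)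

theory Defs
  imports Main "HOL.Hull"
begin

definition is_submonoid :: "nat set \<Rightarrow> bool" where
  "is_submonoid M \<longleftrightarrow> 0 \<in> M \<and> (\<forall>x\<in>M. \<forall>y\<in>M. x + y \<in> M)"

definition generated :: "nat set \<Rightarrow> nat set" where
  "generated X = is_submonoid hull X"

definition is_min_gens :: "nat set \<Rightarrow> nat set \<Rightarrow> bool" where
  "is_min_gens S X \<longleftrightarrow> generated X = S \<and> (\<forall>Y. Y \<subset> X \<longrightarrow> generated Y \<noteq> S)"

text \<open>Meaningful for every submonoid of the natural numbers, by
  \<open>ex1_min_gens\<close> below.\<close>
definition msg :: "nat set \<Rightarrow> nat set" where
  "msg S = (THE X. is_min_gens S X)"

text \<open>The cardinality of an infinite set is 0 here, so a positive lower bound on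
  \<open>embedding_dim S\<close> also asserts that \<open>msg S\<close> is finite.\<close>
definition embedding_dim :: "nat set \<Rightarrow> nat" where
  "embedding_dim S = card (msg S)"

definition T :: "int \<Rightarrow> int \<Rightarrow> int \<Rightarrow> int" where
  "T a b z = a * z + b"

definition s :: "int \<Rightarrow> int \<Rightarrow> int \<Rightarrow> nat \<Rightarrow> int" where
  "s a b m i = (T a b ^^ i) m"

text \<open>The orbit lives in the integers because \<open>b\<close> may be negative. Under
  \<open>a \<ge> 2\<close>, \<open>m > 1\<close> and \<open>b > - (a - 1) * m\<close> all of its
  members are positive (\<open>s_pos\<close> below), so the passage to natural numbers
  loses nothing.\<close>
definition orbit_semigroup :: "int \<Rightarrow> int \<Rightarrow> int \<Rightarrow> nat set" where
  "orbit_semigroup a b m = generated {k. int k \<in> range (s a b m)}"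

text \<open>The division is exact, see \<open>A_mult\<close>.\<close>
definition A :: "int \<Rightarrow> nat \<Rightarrow> int" where
  "A a i = (a ^ i - 1) div (a - 1)"

lemma A_mult: "(a - 1) * A a i = a ^ i - 1"
proof -
  have "a - 1 dvd a ^ i - 1"
    by (metis dvd_triv_left power_diff_1_eq)
  then show ?thesis
    by (simp add: A_def)
qed

lemma s_eq:
  assumes "a \<ge> 2"
  shows "s a b m i = m + A a i * ((a - 1) * m + b)"
proof (induction i)
  case 0
  then show ?case by (simp add: s_def A_def)
next
  case (Suc i)
  have "(a - 1) * A a (Suc i) = (a - 1) * (a * A a i + 1)"
    using A_mult[of a i] A_mult[of a "Suc i"] by (simp add: algebra_simps)
  then have "A a (Suc i) = a * A a i + 1"
    using assms by simp
  then have "m + A a (Suc i) * ((a - 1) * m + b) =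
      a * (m + A a i * ((a - 1) * m + b)) + b"
    by (simp add: algebra_simps)
  with Suc show ?case
    by (simp add: s_def T_def)
qed

lemma s_pos:
  assumes "a \<ge> 2" "m > 1" "b > - (a - 1) * m"
  shows "s a b m i > 0"
proof -
  have "A a i \<ge> 0"
    using assms(1) unfolding A_def by (intro pos_imp_zdiv_nonneg_iff[THEN iffD2]) auto
  moreover have "(a - 1) * m + b > 0"
    using assms(3) by (simp add: algebra_simps)
  ultimately have "A a i * ((a - 1) * m + b) \<ge> 0"
    by simp
  then show ?thesis
    using assms(2) by (simp add: s_eq[OF assms(1)])
qed

lemma is_submonoid_generated: "is_submonoid (generated X)"
  unfolding generated_def by (rule hull_in) (auto simp: is_submonoid_def)

lemma ex1_min_gens:
  assumes "is_submonoid S"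
  shows "\<exists>!X. is_min_gens S X"
proof -
  define B where "B = {x \<in> S. x \<noteq> 0 \<and> \<not> (\<exists>y\<in>S - {0}. \<exists>z\<in>S - {0}. x = y + z)}"
  have sub: "B \<subseteq> X" if X: "generated X = S" for X
  proof
    fix x assume x: "x \<in> B"
    show "x \<in> X"
    proof (rule ccontr)
      assume "x \<notin> X"
      moreover have "X \<subseteq> S"
        using X hull_subset[of X is_submonoid] by (simp add: generated_def)
      moreover have "is_submonoid (S - {x})"
        unfolding is_submonoid_def
      proof (intro conjI ballI)
        show "0 \<in> S - {x}"
          using x assms by (auto simp: B_def is_submonoid_def)
        fix y z assume yz: "y \<in> S - {x}" "z \<in> S - {x}"
        have "y + z \<noteq> x"
          using x yz unfolding B_def by (cases "y = 0"; cases "z = 0") auto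
        then show "y + z \<in> S - {x}"
          using yz assms by (auto simp: is_submonoid_def)
      qed
      ultimately have "generated X \<subseteq> S - {x}"
        unfolding generated_def by (intro hull_minimal) auto
      then show False
        using X x by (auto simp: B_def)
    qed
  qed
  have "S \<subseteq> generated B"
  proof
    fix x assume "x \<in> S"
    then show "x \<in> generated B"
    proof (induction x rule: less_induct)
      case (less x)
      consider "x = 0" | "x \<in> B"
        | y z where "y \<in> S" "z \<in> S" "y \<noteq> 0" "z \<noteq> 0" "x = y + z"
        using less.prems by (auto simp: B_def)
      then show ?case
      proof cases
        case 1
        then show ?thesis
          using is_submonoid_generated[of B] by (simp add: is_submonoid_def)
      next
        case 2
        then show ?thesis
          unfolding generated_def by (rule hull_inc)
      next
        case 3
        then have "y \<in> generated B" "z \<in> generated B"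
          using less.IH by auto
        then show ?thesis
          using is_submonoid_generated[of B] 3(5) by (simp add: is_submonoid_def)
      qed
    qed
  qed
  moreover have "generated B \<subseteq> S"
    unfolding generated_def by (rule hull_minimal) (use assms in \<open>auto simp: B_def\<close>)
  ultimately have gB: "generated B = S"
    by blast
  show ?thesis
  proof (rule ex1I[of _ B])
    show "is_min_gens S B"
      using gB sub unfolding is_min_gens_def by blast
    show "X = B" if "is_min_gens S X" for X
      using that gB sub[of X] unfolding is_min_gens_def by blast
  qed
qed

end

theory Submission
  imports Defs
begin

text \<open>Every nonzero element of \<open>S\<close> has the form \<open>k * m + c * d\<close> with \<open>k \<ge> 1\<close> and
  \<open>c \<ge> 0\<close>, where \<open>d = (a - 1) * m + b\<close>. If \<open>s\<^sub>i = m + A\<^sub>i * d\<close> is a sum of two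
  nonzero elements, then \<open>m + A\<^sub>i * d = k * m + c * d\<close> with \<open>k \<ge> 2\<close>, so
  \<open>(k - 1) * m = (A\<^sub>i - c) * d\<close>. As \<open>d\<close> is positive and coprime to \<open>m\<close>, the
  number \<open>m\<close> divides \<open>A\<^sub>i - c\<close>, which is positive, whence \<open>A\<^sub>i \<ge> m\<close> and
  \<open>i \<ge> n\<close>. Thus the \<open>s\<^sub>i\<close> with \<open>i < n\<close> are irreducible in \<open>S\<close>. The
  irreducibles form the minimal system of generators, which is finite because two
  distinct irreducibles are incongruent modulo \<open>m\<close>.\<close>

section \<open>Irreducible elements and minimal generators\<close>

text \<open>The set \<open>B\<close> from the proof of \<open>ex1_min_gens\<close>, named so that
  \<open>msg\<close> can be computed.\<close>

definition irreducibles :: "nat set \<Rightarrow> nat set" where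
  "irreducibles S = {x \<in> S. x \<noteq> 0 \<and> (\<forall>y\<in>S - {0}. \<forall>z\<in>S - {0}. x \<noteq> y + z)}"

lemma subset_generated: "X \<subseteq> generated X"
  unfolding generated_def by (rule hull_subset)

lemma generated_minimal: "X \<subseteq> M \<Longrightarrow> is_submonoid M \<Longrightarrow> generated X \<subseteq> M"
  unfolding generated_def by (rule hull_minimal)

lemma is_submonoid_Diff_irreducible:
  assumes "is_submonoid S" "x \<in> irreducibles S"
  shows "is_submonoid (S - {x})"
  unfolding is_submonoid_def
proof (intro conjI ballI)
  show "0 \<in> S - {x}"
    using assms by (auto simp: irreducibles_def is_submonoid_def)
  fix y z assume yz: "y \<in> S - {x}" "z \<in> S - {x}"
  have "y + z \<noteq> x"
    using assms(2) yz unfolding irreducibles_def by (cases "y = 0"; cases "z = 0") auto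
  then show "y + z \<in> S - {x}"
    using yz assms(1) by (auto simp: is_submonoid_def)
qed

text \<open>If an irreducible \<open>x\<close> were missing from \<open>X\<close>, then removing
  \<open>x\<close> would leave a smaller submonoid that still contains \<open>X\<close>.\<close>

lemma irreducibles_subset_generators: "irreducibles (generated X) \<subseteq> X"
proof
  fix x assume x: "x \<in> irreducibles (generated X)"
  show "x \<in> X"
  proof (rule ccontr)
    assume "x \<notin> X"
    then have "generated X \<subseteq> generated X - {x}"
      using subset_generated[of X]
        is_submonoid_Diff_irreducible[OF is_submonoid_generated x]
      by (intro generated_minimal) auto
    then show False
      using x by (auto simp: irreducibles_def)
  qed
qed

text \<open>Strong induction: a nonzero reducible element is a sum of two strictly smaller elements
  of \<open>S\<close>.\<close>

lemma generated_irreducibles: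
  assumes "is_submonoid S"
  shows "generated (irreducibles S) = S"
proof
  show "generated (irreducibles S) \<subseteq> S"
    using assms by (intro generated_minimal) (auto simp: irreducibles_def)
  show "S \<subseteq> generated (irreducibles S)"
  proof
    fix x assume "x \<in> S"
    then show "x \<in> generated (irreducibles S)"
    proof (induction x rule: less_induct)
      case (less x)
      consider "x = 0" | "x \<in> irreducibles S"
        | y z where "y \<in> S" "z \<in> S" "y \<noteq> 0" "z \<noteq> 0" "x = y + z"
        using less.prems by (auto simp: irreducibles_def)
      then show ?case
      proof cases
        case 1
        then show ?thesis
          using is_submonoid_generated by (simp add: is_submonoid_def)
      next
        case 2
        then show ?thesis
          using subset_generated by blast
      next
        case 3
        then have "y \<in> generated (irreducibles S)" "z \<in> generated (irreducibles S)"
          using less.IH by auto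
        then show ?thesis
          using is_submonoid_generated 3(5) by (simp add: is_submonoid_def)
      qed
    qed
  qed
qed

lemma msg_eq_irreducibles:
  assumes "is_submonoid S"
  shows "msg S = irreducibles S"
  unfolding msg_def
proof (rule the1_equality)
  show "\<exists>!X. is_min_gens S X"
    using assms by (rule ex1_min_gens)
  show "is_min_gens S (irreducibles S)"
    using generated_irreducibles[OF assms] irreducibles_subset_generators
    unfolding is_min_gens_def by blast
qed

lemma submonoid_mult_closed:
  assumes "is_submonoid S" "x \<in> S"
  shows "k * x \<in> S"
  using assms by (induction k) (auto simp: is_submonoid_def)

text \<open>Reduction modulo \<open>x\<close> is injective on irreducibles: for congruent
  \<open>y < z\<close>, the difference is a nonzero multiple of \<open>x\<close>, hence in
  \<open>S\<close>, and \<open>z\<close> splits.\<close>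

lemma finite_irreducibles:
  assumes "is_submonoid S" "x \<in> S" "x \<noteq> 0"
  shows "finite (irreducibles S)"
proof (rule inj_on_finite)
  have *: "\<not> y < z" if "y \<in> irreducibles S" "z \<in> irreducibles S" "y mod x = z mod x" for y z
  proof
    assume "y < z"
    then have "x dvd z - y"
      by (simp flip: mod_eq_dvd_iff_nat add: that(3))
    then obtain k where k: "z - y = k * x"
      by (metis dvdE mult.commute)
    have sum: "z = y + k * x" and nz: "k * x \<noteq> 0"
      using \<open>y < z\<close> by (simp_all flip: k)
    have "y \<in> S - {0}" "k * x \<in> S - {0}"
      using that(1) nz submonoid_mult_closed[OF assms(1,2), of k]
      by (simp_all add: irreducibles_def)
    moreover have "\<forall>y\<in>S - {0}. \<forall>w\<in>S - {0}. z \<noteq> y + w"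
      using that(2) by (simp add: irreducibles_def)
    ultimately have "z \<noteq> y + k * x"
      by (metis (no_types))
    then show False
      using sum by contradiction
  qed
  show "inj_on (\<lambda>y. y mod x) (irreducibles S)"
    by (rule inj_onI) (use * in \<open>metis linorder_neqE_nat\<close>)
  show "(\<lambda>y. y mod x) ` irreducibles S \<subseteq> {..<x}"
    using assms(3) by auto
qed simp

section \<open>The sequences \<open>A\<close> and \<open>s\<close>\<close>

lemma A_0: "A a 0 = 0"
  by (simp add: A_def)

text \<open>Both sides agree after multiplication by \<open>a - 1\<close>, which is nonzero. The
  recurrence replaces the division in later arguments.\<close>

lemma A_Suc:
  assumes "a \<ge> 2"
  shows "A a (Suc i) = a * A a i + 1"
proof -
  have "(a - 1) * A a (Suc i) = (a - 1) * (a * A a i + 1)"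
    using A_mult[of a i] A_mult[of a "Suc i"] by (simp add: algebra_simps)
  then show ?thesis
    using assms by simp
qed

lemma A_nonneg: "a \<ge> 2 \<Longrightarrow> A a i \<ge> 0"
  by (induction i) (auto simp: A_0 A_Suc)

lemma strict_mono_A:
  assumes "a \<ge> 2"
  shows "strict_mono (A a)"
  unfolding strict_mono_Suc_iff
proof
  fix i
  have "1 * A a i \<le> a * A a i"
    using assms A_nonneg[OF assms] by (intro mult_right_mono) auto
  then show "A a i < A a (Suc i)"
    by (simp add: A_Suc[OF assms])
qed

lemma inj_s:
  assumes "a \<ge> 2" "b > - (a - 1) * m"
  shows "inj (s a b m)"
proof (rule injI)
  fix i j assume "s a b m i = s a b m j"
  moreover have "(a - 1) * m + b \<noteq> 0"
    using assms(2) by (simp add: algebra_simps)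
  ultimately have "A a i = A a j"
    by (simp add: s_eq[OF assms(1)])
  then show "i = j"
    using strict_mono_A[OF assms(1)] by (simp add: strict_mono_eq)
qed

section \<open>The semigroup generated by the orbit\<close>

lemma s_in_orbit_semigroup:
  assumes "a \<ge> 2" "m > 1" "b > - (a - 1) * m"
  shows "nat (s a b m i) \<in> orbit_semigroup a b m"
proof -
  have "nat (s a b m i) \<in> {k. int k \<in> range (s a b m)}"
    using s_pos[OF assms, of i] by simp
  then show ?thesis
    unfolding orbit_semigroup_def by (rule subsetD[OF subset_generated])
qed

text \<open>Such numbers form a submonoid containing each \<open>s a b m i\<close>, with
  \<open>k = 1\<close> and \<open>c = A a i\<close>; \<open>k\<close> counts the generators in a
  sum. The bound \<open>k \<ge> 0\<close> also covers \<open>x = 0\<close>, so that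
  \<open>k \<ge> 1\<close> survives adding zero.\<close>

lemma orbit_semigroup_form:
  assumes "a \<ge> 2" "x \<in> orbit_semigroup a b m"
  shows "\<exists>k c. c \<ge> 0 \<and> (x \<noteq> 0 \<longrightarrow> k \<ge> 1) \<and> k \<ge> 0 \<and> int x = k * m + c * ((a - 1) * m + b)"
proof -
  define M where "M = {x. \<exists>k c. c \<ge> 0 \<and> (x \<noteq> 0 \<longrightarrow> k \<ge> 1) \<and> k \<ge> 0 \<and>
    int x = k * m + c * ((a - 1) * m + b)}"
  have "is_submonoid M"
    unfolding is_submonoid_def
  proof (intro conjI ballI)
    show "0 \<in> M"
      unfolding M_def by (auto intro!: exI[of _ 0])
    fix x y assume "x \<in> M" "y \<in> M"
    then obtain k c l e
      where "c \<ge> 0" "x \<noteq> 0 \<longrightarrow> k \<ge> 1" "k \<ge> 0" "int x = k * m + c * ((a - 1) * m + b)"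
        and "e \<ge> 0" "y \<noteq> 0 \<longrightarrow> l \<ge> 1" "l \<ge> 0" "int y = l * m + e * ((a - 1) * m + b)"
      unfolding M_def by blast
    then show "x + y \<in> M"
      unfolding M_def mem_Collect_eq
      by - (rule exI[of _ "k + l"], rule exI[of _ "c + e"], auto simp: distrib_right)
  qed
  moreover have "{k. int k \<in> range (s a b m)} \<subseteq> M"
  proof
    fix x assume "x \<in> {k. int k \<in> range (s a b m)}"
    then obtain i where "int x = m + A a i * ((a - 1) * m + b)"
      using s_eq[OF assms(1)] by auto
    then show "x \<in> M"
      unfolding M_def using A_nonneg[OF assms(1), of i]
      by - (rule CollectI, rule exI[of _ 1], rule exI[of _ "A a i"], simp)
  qed
  ultimately have "orbit_semigroup a b m \<subseteq> M"
    unfolding orbit_semigroup_def by (intro generated_minimal)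
  then have "x \<in> M"
    using assms(2) by (rule subsetD)
  then show ?thesis
    by (simp only: M_def mem_Collect_eq)
qed

lemma s_irreducible:
  assumes "a \<ge> 2" "m > 1" "gcd b m = 1" "b > - (a - 1) * m" "A a i < m"
  shows "nat (s a b m i) \<in> irreducibles (orbit_semigroup a b m)"
proof -
  let ?S = "orbit_semigroup a b m"
  define d where "d = (a - 1) * m + b"
  have d: "d > 0"
    using assms(4) by (simp add: d_def algebra_simps)
  have "coprime b m"
    using assms(3) by (simp add: coprime_iff_gcd_eq_1)
  \<comment> \<open>\<open>d\<close> is \<open>b\<close> plus a multiple of \<open>m\<close>, so it
    has the same gcd with \<open>m\<close>.\<close>
  then have cop: "coprime m d"
    by (metis d_def coprime_commute coprime_iff_gcd_eq_1 gcd_add_mult)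
  have "nat (s a b m i) \<noteq> y + z" if yz: "y \<in> ?S - {0}" "z \<in> ?S - {0}" for y z
  proof
    assume eq: "nat (s a b m i) = y + z"
    obtain k c where kc: "c \<ge> 0" "k \<ge> 1" "int y = k * m + c * d"
      using orbit_semigroup_form[OF assms(1), of y b m] yz(1) unfolding d_def by auto
    obtain l e where le: "e \<ge> 0" "l \<ge> 1" "int z = l * m + e * d"
      using orbit_semigroup_form[OF assms(1), of z b m] yz(2) unfolding d_def by auto
    have "m + A a i * d = int y + int z"
      using eq s_pos[OF assms(1,2,4), of i] s_eq[OF assms(1), of b m i]
      unfolding d_def by simp
    then have *: "(k + l - 1) * m = (A a i - (c + e)) * d"
      using kc(3) le(3) by (simp add: algebra_simps)
    \<comment> \<open>Two nonzero summands give \<open>k + l \<ge> 2\<close>; this is where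
      reducibility enters.\<close>
    have "(k + l - 1) * m > 0"
      using kc(2) le(2) assms(2) by simp
    then have pos: "A a i - (c + e) > 0"
      using * d by (simp add: zero_less_mult_iff)
    have "m dvd (A a i - (c + e)) * d"
      using * by (metis dvd_triv_right)
    then have "m dvd A a i - (c + e)"
      using cop by (simp add: coprime_dvd_mult_left_iff)
    then have "m \<le> A a i - (c + e)"
      using pos by (rule zdvd_imp_le)
    then show False
      using assms(5) kc(1) le(1) by simp
  qed
  then show ?thesis
    using s_in_orbit_semigroup[OF assms(1,2,4)] s_pos[OF assms(1,2,4), of i]
    unfolding irreducibles_def by auto
qed

theorem proposition3p1:
  fixes a b m :: int and n :: nat and S :: "nat set"
  assumes "a \<ge> 2"
    and "m > 1"
    and "gcd b m = 1"
    and "b > - (a - 1) * m"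
    and "S = orbit_semigroup a b m"
    and "n = (LEAST k. k > 0 \<and> A a k \<ge> m)"
  shows "s a b m ` {0..<n} \<subseteq> int ` msg S \<and> embedding_dim S \<ge> n"
proof -
  have S: "is_submonoid S"
    unfolding assms(5) orbit_semigroup_def by (rule is_submonoid_generated)
  have msg: "msg S = irreducibles S"
    using S by (rule msg_eq_irreducibles)
  have sub: "s a b m ` {0..<n} \<subseteq> int ` msg S"
  proof
    fix x assume "x \<in> s a b m ` {0..<n}"
    then obtain i where i: "i < n" "x = s a b m i"
      by auto
    have "A a i < m"
    \<comment> \<open>Minimality of \<open>n\<close> only concerns positive indices; at index 0 the
      bound is \<open>0 < m\<close>.\<close>
    proof (cases "i = 0")
      case True
      then show ?thesis
        using assms(2) by (simp add: A_0)
    next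
      case False
      then show ?thesis
        using not_less_Least[of i "\<lambda>k. k > 0 \<and> A a k \<ge> m"] i(1) assms(6) by auto
    qed
    then have "nat x \<in> msg S"
      using s_irreducible[OF assms(1-4)] i(2) msg assms(5) by simp
    moreover have "x = int (nat x)"
      using s_pos[OF assms(1,2,4), of i] i(2) by simp
    ultimately show "x \<in> int ` msg S"
      by blast
  qed
  \<comment> \<open>Residues are taken modulo \<open>s a b m 0\<close>, which is \<open>m\<close>.
    Without finiteness \<open>card\<close> could default to 0.\<close>
  have "finite (msg S)"
    using finite_irreducibles[OF S, of "nat (s a b m 0)"] s_pos[OF assms(1,2,4), of 0]
      s_in_orbit_semigroup[OF assms(1,2,4), of 0] assms(5) msg by simp
  then have "card (s a b m ` {0..<n}) \<le> card (int ` msg S)"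
    using sub by (intro card_mono) auto
  moreover have "card (s a b m ` {0..<n}) = n"
    using inj_s[OF assms(1,4)] by (simp add: card_image inj_on_subset)
  ultimately show ?thesis
    using sub by (simp add: embedding_dim_def card_image)
qed

end
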